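(* Let $D$ be uniform, $n=d_m+1$, and let $\alpha=\sum_{k\ge1}\alpha_kn^{-k}$ be a $\Delta$ representation. Define $\hat\alpha:=\sum_{k\ge1}\hat\alpha_kn^{-k}$ with $\hat\alpha_k:=d_m-|\alpha_k|$ for each $k$. There exists an integer $q>0$ such that $D_{|\alpha_j|}\subseteq D_{|\alpha_{j+q}|}$ for all $j>0$ if and only if there exist an integer $p>0$ and $\boldsymbol{u}=(u_1,\ldots,u_p)$, $\boldsymbol{v}=(v_1,\ldots,v_p)\in D^p$ such that $u_j\le v_j$ for all $1\le j\le p$ and $\hat\alpha=0._n u_1\cdots u_p\overline{v_1\cdots v_p}$.
   Context: $n\ge 3$ is an integer and $D=\{d_1<d_2<\cdots<d_m\}\subseteq\{0,1,\ldots,n-1\}$ is a digit set with $2\le m<n$ and $d_1=0$. $D$ is uniform if $d_{k+1}-d_k$, $k=1,\ldots,m-1$, is constant and $\ge2$. $\Delta:=D-D$. A $\Delta$ representation of $\alpha$ is an expression $\alpha=\sum_{k\ge1}\alpha_kn^{-k}$ with all $\alpha_k\in\Delta$. For an integer $\delta$ with $D\cap(D+\delta)\ne\varnothing$, $D_\delta:=D\cap(D+\delta)-\min(D\cap(D+\delta))$. The notation $0._n x_1x_2\cdots$ means $\sum_{k\ge1}x_kn^{-k}$, and an overline denotes a block of digits repeated forever. *)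

theory Defs
  imports Complex_Main "HOL-Library.FuncSet"
begin

text \<open>Digit sequences are indexed from \<open>1\<close>; the value at index \<open>0\<close> is never used.\<close>

definition digit_set :: "nat \<Rightarrow> nat \<Rightarrow> (nat \<Rightarrow> int) \<Rightarrow> int set \<Rightarrow> bool" where
  "digit_set n m d D \<longleftrightarrow>
     3 \<le> n \<and> 2 \<le> m \<and> m < n \<and> D = d ` {1..m} \<and> strict_mono_on {1..m} d \<and>
     D \<subseteq> {0..int n - 1} \<and> d 1 = 0"

definition uniform :: "nat \<Rightarrow> (nat \<Rightarrow> int) \<Rightarrow> bool" where
  "uniform m d \<longleftrightarrow> (\<exists>c\<ge>2. \<forall>k\<in>{1..m - 1}. d (k + 1) - d k = c)"

definition difference_set :: "int set \<Rightarrow> int set" where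
  "difference_set D = {x - y | x y. x \<in> D \<and> y \<in> D}"

definition shift_inter :: "int set \<Rightarrow> int \<Rightarrow> int set" where
  "shift_inter D \<delta> = D \<inter> (\<lambda>x. x + \<delta>) ` D"

text \<open>The set \<open>D\<^sub>\<delta>\<close>; only meaningful when \<^term>\<open>shift_inter D \<delta>\<close> is finite and nonempty.\<close>

definition reduced_inter :: "int set \<Rightarrow> int \<Rightarrow> int set" where
  "reduced_inter D \<delta> = (\<lambda>x. x - Min (shift_inter D \<delta>)) ` shift_inter D \<delta>"

text \<open>The real number \<open>0.x\<^sub>1x\<^sub>2\<dots>\<close> in base \<open>n\<close>, i.e. the sum of \<open>x\<^sub>k / n\<^sup>k\<close> over \<open>k \<ge> 1\<close>;
  negative digits are allowed.\<close>

definition radix_value :: "nat \<Rightarrow> (nat \<Rightarrow> int) \<Rightarrow> real" where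
  "radix_value n x = (\<Sum>k. of_int (x (Suc k)) / real n ^ Suc k)"

definition delta_representation :: "nat \<Rightarrow> int set \<Rightarrow> (nat \<Rightarrow> int) \<Rightarrow> real \<Rightarrow> bool" where
  "delta_representation n D x \<alpha> \<longleftrightarrow>
     (\<forall>k\<ge>1. x k \<in> difference_set D) \<and> \<alpha> = radix_value n x"

text \<open>The digit sequence \<open>u\<^sub>1 \<dots> u\<^sub>p\<close> followed by the block \<open>v\<^sub>1 \<dots> v\<^sub>p\<close> repeated forever.\<close>

definition preperiod_period :: "nat \<Rightarrow> (nat \<Rightarrow> int) \<Rightarrow> (nat \<Rightarrow> int) \<Rightarrow> nat \<Rightarrow> int" where
  "preperiod_period p u v k = (if k \<le> p then u k else v ((k - p - 1) mod p + 1))"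

end

theory Submission
  imports Defs
begin

text \<open>
  If \<open>D = {0, c, \<dots>, (m - 1) c}\<close>, then \<open>D\<^sub>\<delta> = D \<inter> {0..d\<^sub>m - \<delta>}\<close> for \<open>0 \<le> \<delta> \<in> D\<close>, so the inclusions
  say that the digits of \<open>\<alpha>_hat\<close> satisfy \<open>a_hat j \<le> a_hat (j + q)\<close>.  Since these digits are bounded
  integers, each residue class modulo \<open>q\<close> is eventually constant, and any sufficiently large multiple
  of \<open>q\<close> serves as \<open>p\<close>.  Conversely, digits of \<open>D\<close> never differ by exactly \<open>1\<close> as \<open>c \<ge> 2\<close>, hence
  radix representations over \<open>D\<close> are unique, and one may take \<open>q = p\<close>.
\<close>

section \<open>Uniqueness of radix expansions whose digits never differ by one\<close>

lemma sums_max_digit: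
  assumes "2 \<le> n"
  shows "(\<lambda>i. (real n - 1) / real n ^ (Suc i + k)) sums (1 / real n ^ k)"
proof -
  have "(\<lambda>i. (1 / real n) ^ i) sums (1 / (1 - 1 / real n))"
    using assms by (intro geometric_sums) auto
  from sums_mult[OF this, of "(real n - 1) / real n ^ Suc k"]
  have "(\<lambda>i. (real n - 1) / real n ^ (Suc i + k)) sums
      ((real n - 1) / real n ^ Suc k * (1 / (1 - 1 / real n)))"
    by (simp add: power_add power_one_over mult_ac divide_inverse power_inverse)
  moreover have "(real n - 1) / real n ^ Suc k * (1 / (1 - 1 / real n)) = 1 / real n ^ k"
    using assms by (simp add: divide_simps)
  ultimately show ?thesis by metis
qed

lemma summable_digits:
  fixes z :: "nat \<Rightarrow> int"
  assumes "2 \<le> n" and "\<And>k. \<bar>z k\<bar> \<le> int n - 1"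
  shows "summable (\<lambda>k. of_int (z k) / real n ^ Suc k)"
proof (rule summable_comparison_test')
  show "summable (\<lambda>k. (real n - 1) / real n ^ Suc k)"
    using sums_max_digit[OF assms(1), of 0] by (auto simp: summable_def)
  fix k
  have "real_of_int \<bar>z k\<bar> \<le> real n - 1"
    using assms(2)[of k] by linarith
  then show "norm (of_int (z k) / real n ^ Suc k) \<le> (real n - 1) / real n ^ Suc k"
    by (simp add: divide_right_mono)
qed

text \<open>At the first nonzero digit, the remaining tail is worth at most one unit of that
  position, so this digit would have absolute value 1. Excluding \<open>1\<close> is essential: the
  digits \<open>1, -(n - 1), -(n - 1), ...\<close> also have value 0.\<close>

lemma radix_zero_unique:
  fixes z :: "nat \<Rightarrow> int"
  assumes n: "2 \<le> n" and bound: "\<And>k. \<bar>z k\<bar> \<le> int n - 1" and gap: "\<And>k. \<bar>z k\<bar> \<noteq> 1"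
    and zero: "(\<Sum>k. of_int (z k) / real n ^ Suc k) = 0"
  shows "z k = 0"
proof (induction k rule: less_induct)
  case (less k)
  let ?f = "\<lambda>k. of_int (z k) / real n ^ Suc k"
  have sm: "summable ?f"
    using n bound by (rule summable_digits)
  have "0 = (\<Sum>i. ?f (i + Suc k)) + sum ?f {..<Suc k}"
    using suminf_split_initial_segment[OF sm, of "Suc k"] zero by simp
  \<comment> \<open>By the induction hypothesis all earlier digits vanish, so digit \<open>k\<close>
    must cancel the tail exactly.\<close>
  also have "sum ?f {..<Suc k} = ?f k"
    using less.IH by simp
  finally have "\<bar>?f k\<bar> = \<bar>\<Sum>i. ?f (i + Suc k)\<bar>"
    by linarith
  also have "\<dots> \<le> (\<Sum>i. (real n - 1) / real n ^ (Suc i + Suc k))"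
    unfolding real_norm_def[symmetric]
  proof (rule norm_suminf_le)
    show "summable (\<lambda>i. (real n - 1) / real n ^ (Suc i + Suc k))"
      using sums_max_digit[OF n] by (rule sums_summable)
    fix i
    have "real_of_int \<bar>z (i + Suc k)\<bar> \<le> real n - 1"
      using bound[of "i + Suc k"] by linarith
    then show "norm (?f (i + Suc k)) \<le> (real n - 1) / real n ^ (Suc i + Suc k)"
      using divide_right_mono[of _ _ "real n ^ (Suc i + Suc k)"] by simp
  qed
  also have "\<dots> = 1 / real n ^ Suc k"
    using sums_max_digit[OF n] by (rule sums_unique[symmetric])
  finally have "\<bar>real_of_int (z k)\<bar> / real n ^ Suc k \<le> 1 / real n ^ Suc k"
    by simp
  then have "\<bar>real_of_int (z k)\<bar> \<le> 1"
    using n by (simp add: divide_le_cancel)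
  then show "z k = 0"
    using gap[of k] by linarith
qed

text \<open>The digitwise difference of the two sequences expands 0, and its digits satisfy the
  bound and the gap condition of \<open>radix_zero_unique\<close>.\<close>

lemma radix_value_eq_imp_digits_eq:
  assumes n: "2 \<le> n"
    and x: "\<And>k. k \<ge> 1 \<Longrightarrow> x k \<in> {0..int n - 1}" and y: "\<And>k. k \<ge> 1 \<Longrightarrow> y k \<in> {0..int n - 1}"
    and gap: "\<And>k. k \<ge> 1 \<Longrightarrow> \<bar>x k - y k\<bar> \<noteq> 1"
    and eq: "radix_value n x = radix_value n y" and "k \<ge> 1"
  shows "x k = y k"
proof -
  have x': "\<bar>x (Suc k)\<bar> \<le> int n - 1" and y': "\<bar>y (Suc k)\<bar> \<le> int n - 1"
    and d: "\<bar>x (Suc k) - y (Suc k)\<bar> \<le> int n - 1" for k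
    using x[of "Suc k"] y[of "Suc k"] by auto
  have "(\<Sum>k. of_int (x (Suc k) - y (Suc k)) / real n ^ Suc k) = 0"
    using suminf_diff[OF summable_digits[of n "\<lambda>k. x (Suc k)", OF n x']
        summable_digits[of n "\<lambda>k. y (Suc k)", OF n y']] eq
    by (simp add: radix_value_def diff_divide_distrib)
  \<comment> \<open>The series is indexed from 0, so digit \<open>k\<close> of the expansion is its
    term \<open>k - 1\<close>.\<close>
  from radix_zero_unique[OF n d _ this, of "k - 1"] gap \<open>k \<ge> 1\<close> show ?thesis
    by simp
qed

section \<open>Eventual periodicity of bounded sequences that are monotone along steps of length
  \<open>q\<close>\<close>

text \<open>The window sums \<open>f j + \<dots> + f (j + q - 1)\<close> increase by \<open>f (j + q) - f j\<close> and are bounded, so they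
  are constant from a maximal one on.\<close>

lemma bounded_quasi_mono_eventually_periodic:
  fixes f :: "nat \<Rightarrow> int"
  assumes bound: "\<And>j. f j \<le> B" and mono: "\<And>j. f j \<le> f (j + q)"
  shows "\<exists>N. \<forall>j\<ge>N. f (j + q) = f j"
proof -
  define g where "g j = (\<Sum>i<q. f (j + i))" for j
  have step: "g (Suc j) = g j + (f (j + q) - f j)" for j
    using sum.lessThan_Suc_shift[of "\<lambda>i. f (j + i)" q] by (simp add: g_def)
  have "incseq g"
    using mono by (intro incseq_SucI) (simp add: step)
  have gB: "g j \<le> int q * B" for j
    using sum_bounded_above[of "{..<q}" "\<lambda>i. f (j + i)" B] bound by (simp add: g_def)
  \<comment> \<open>A maximum of \<open>g\<close> is found as a minimum of its distance to the upper
    bound \<open>int q * B\<close>. By \<open>gB\<close> this distance is nonnegative, so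
    \<open>nat\<close> truncates nothing.\<close>
  obtain N where "\<And>j. nat (int q * B - g N) \<le> nat (int q * B - g j)"
    using ex_has_least_nat[of "\<lambda>_. True" _ "\<lambda>j. nat (int q * B - g j)"] by auto
  then have max: "g j \<le> g N" for j
    using gB[of j] gB[of N] by (smt (verit) nat_le_eq_zle)
  have "g j = g N" if "j \<ge> N" for j
    using incseqD[OF \<open>incseq g\<close> that] max[of j] by simp
  then have "f (j + q) = f j" if "j \<ge> N" for j
    using step[of j] that by (metis add_cancel_right_right eq_iff_diff_eq_0 le_SucI)
  then show ?thesis by blast
qed

section \<open>Reduced intersections of an arithmetic progression\<close>

lemma arithmetic_reduced_inter:
  fixes c e M :: int
  assumes c: "c > 0" and e: "0 \<le> e" "e \<le> M"
  shows "reduced_inter ((*) c ` {0..M}) (c * e) = (*) c ` {0..M - e}"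
proof -
  have "(\<lambda>x. x + c * e) ` (*) c ` {0..M} = (*) c ` (\<lambda>i. i + e) ` {0..M}"
    by (simp only: image_image distrib_left)
  also have "(\<lambda>i. i + e) ` {0..M} = {e..M + e}"
    by simp
  finally have "shift_inter ((*) c ` {0..M}) (c * e) = (*) c ` ({0..M} \<inter> {e..M + e})"
    using c by (simp add: shift_inter_def image_Int[symmetric] inj_def)
  also have "{0..M} \<inter> {e..M + e} = {e..M}"
    using e by auto
  finally have S: "shift_inter ((*) c ` {0..M}) (c * e) = (*) c ` {e..M}" .
  have "Min ((*) c ` {e..M}) = c * e"
    using c e by (intro Min_eqI) auto
  then have "reduced_inter ((*) c ` {0..M}) (c * e) = (*) c ` (\<lambda>i. i - e) ` {e..M}"
    by (simp only: reduced_inter_def S image_image right_diff_distrib)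
  also have "(\<lambda>i. i - e) ` {e..M} = {0..M - e}"
    by simp
  finally show ?thesis .
qed

text \<open>Multiplication by \<open>c\<close> is injective, so the intervals
  \<open>{0..M - e}\<close> and \<open>{0..M - e'}\<close> are compared. They are nonempty and share
  their left end, hence inclusion is decided by the right ends.\<close>

lemma arithmetic_reduced_inter_subset_iff:
  fixes c e e' M :: int
  assumes "c > 0" and "0 \<le> e" "e \<le> M" and "0 \<le> e'" "e' \<le> M"
  shows "reduced_inter ((*) c ` {0..M}) (c * e) \<subseteq> reduced_inter ((*) c ` {0..M}) (c * e') \<longleftrightarrow>
         e' \<le> e"
  using assms by (simp add: arithmetic_reduced_inter inj_image_subset_iff inj_def)

lemma uniform_digit_set_arithmetic:
  assumes "digit_set n m d D" and "uniform m d"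
  obtains c where "c \<ge> 2" and "D = (*) c ` {0..int (m - 1)}" and "d m = c * int (m - 1)"
proof -
  obtain c where c: "c \<ge> 2" and step: "\<And>k. k \<in> {1..m - 1} \<Longrightarrow> d (k + 1) - d k = c"
    using assms(2) by (auto simp: uniform_def)
  have m: "2 \<le> m" and D: "D = d ` {1..m}" and d1: "d 1 = 0"
    using assms(1) by (auto simp: digit_set_def)
  have d: "d (Suc i) = c * int i" if "i < m" for i
    using that
  proof (induction i)
    case 0
    then show ?case using d1 by simp
  next
    case (Suc i)
    then show ?case using step[of "Suc i"] by (simp add: algebra_simps)
  qed
  have "{1..m} = Suc ` {0..m - 1}"
    using m by (simp only: image_Suc_atLeastAtMost) simp
  then have "D = (\<lambda>i. d (Suc i)) ` {0..m - 1}"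
    by (simp only: D image_image)
  also have "\<dots> = (\<lambda>i. c * int i) ` {0..m - 1}"
    using m by (intro image_cong) (auto simp: d)
  also have "\<dots> = (*) c ` int ` {0..m - 1}"
    by (simp add: image_image)
  finally have "D = (*) c ` {0..int (m - 1)}"
    by (simp add: image_int_atLeastAtMost)
  moreover have "d m = c * int (m - 1)"
    using d[of "m - 1"] m by simp
  ultimately show thesis
    using c that by blast
qed

section \<open>Digit sequences with equally long preperiod and period\<close>

lemma eventually_periodic_add_mult:
  fixes f :: "nat \<Rightarrow> 'a"
  assumes "\<And>j. j \<ge> N \<Longrightarrow> f (j + q) = f j" and "j \<ge> N"
  shows "f (j + q * k) = f j"
proof (induction k)
  case (Suc k)
  have "f (j + q * Suc k) = f (j + q * k + q)"
    by (simp add: algebra_simps)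
  then show ?case
    using assms Suc by simp
qed simp

text \<open>The sequence itself serves as preperiod and its shift by \<open>p\<close> as period,
  which is correct once \<open>p\<close> is a multiple of \<open>q\<close> and position
  \<open>p\<close> lies in the periodic range.\<close>

lemma quasi_mono_imp_preperiod_period:
  fixes x :: "nat \<Rightarrow> int"
  assumes q: "q > 0" and bound: "\<And>j. j > 0 \<Longrightarrow> x j \<le> B"
    and mono: "\<And>j. j > 0 \<Longrightarrow> x j \<le> x (j + q)"
  obtains p where "p > 0" and "\<And>j. j > 0 \<Longrightarrow> x j \<le> x (j + p)"
    and "\<And>k. k > 0 \<Longrightarrow> preperiod_period p x (\<lambda>j. x (j + p)) k = x k"
proof -
  \<comment> \<open>Nothing is assumed about \<open>x 0\<close>, so the sequence is reindexed from
    0.\<close>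
  define f where "f j = x (Suc j)" for j
  obtain N where N: "\<And>j. j \<ge> N \<Longrightarrow> f (j + q) = f j"
    using bounded_quasi_mono_eventually_periodic[of f B q] bound mono unfolding f_def
    by (metis add_Suc zero_less_Suc)
  \<comment> \<open>The factor \<open>Suc N\<close> instead of \<open>N\<close> keeps
    \<open>p\<close> positive when \<open>N = 0\<close>.\<close>
  define p where "p = q * Suc N"
  have "1 * Suc N \<le> p"
    unfolding p_def using q by (intro mult_le_mono1) simp
  then have "p \<ge> N" "p > 0"
    by simp_all
  have "x j \<le> x (j + q * k)" if "j > 0" for j k
  proof (induction k)
    case (Suc k)
    then show ?case
      using mono[of "j + q * k"] that by (simp add: algebra_simps)
  qed simp
  then have "x j \<le> x (j + p)" if "j > 0" for j
    using that by (simp add: p_def del: mult_Suc_right)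
  moreover have "preperiod_period p x (\<lambda>j. x (j + p)) k = x k" if "k > 0" for k
  proof (cases "k \<le> p")
    case False
    define t where "t = k - p - 1"
    have k: "k = Suc (p + t)"
      using False by (simp add: t_def)
    \<comment> \<open>The offsets \<open>t\<close> and \<open>t mod p\<close> into the repeated part
      differ by a multiple of \<open>p\<close>, hence of \<open>q\<close>, and both positions are at
      least \<open>N\<close>.\<close>
    have "f (p + t mod p + q * (Suc N * (t div p))) = f (p + t mod p)"
      using N \<open>p \<ge> N\<close> by (intro eventually_periodic_add_mult[of N]) auto
    also have "p + t mod p + q * (Suc N * (t div p)) = p + t"
      using mod_mult_div_eq[of t p] by (simp only: p_def mult.assoc add.assoc)
    finally have "x (Suc (p + t mod p)) = x k"
      by (simp add: f_def k)
    then show ?thesis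
      using False by (simp add: preperiod_period_def t_def add.commute)
  qed (simp add: preperiod_period_def)
  ultimately show thesis
    using \<open>p > 0\<close> that by blast
qed

lemma preperiod_period_in:
  assumes "p > 0" and "u \<in> {1..p} \<rightarrow> D" and "v \<in> {1..p} \<rightarrow> D" and "k \<ge> 1"
  shows "preperiod_period p u v k \<in> D"
proof (cases "k \<le> p")
  case False
  have "(k - p - 1) mod p + 1 \<in> {1..p}"
    using assms(1) by (simp add: Suc_leI)
  then show ?thesis
    using assms(3) False by (simp add: preperiod_period_def Pi_def)
qed (use assms in \<open>auto simp: preperiod_period_def Pi_def\<close>)

text \<open>A shift by \<open>p\<close> takes the preperiod entry \<open>u j\<close> to
  \<open>v j\<close>; within the repeated part it changes nothing.\<close>

lemma preperiod_period_le_shift: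
  assumes "p > 0" and "\<forall>j\<in>{1..p}. u j \<le> v j" and "j > 0"
  shows "preperiod_period p u v j \<le> preperiod_period p u v (j + p)"
proof (cases "j \<le> p")
  case True
  then have "(j - 1) mod p = j - 1"
    using assms by (intro mod_less) linarith
  then show ?thesis
    using assms True by (simp add: preperiod_period_def)
next
  case False
  then have "j + p - p - 1 = j - p - 1 + p"
    by simp
  then have "(j + p - p - 1) mod p = (j - p - 1) mod p"
    by (metis mod_add_self2)
  then show ?thesis
    using False assms by (simp add: preperiod_period_def)
qed

theorem proposition6p6:
  fixes n m :: nat and d a a_hat :: "nat \<Rightarrow> int" and D :: "int set" and \<alpha> \<alpha>_hat :: real
  assumes "digit_set n m d D"
    and "uniform m d"
    and "int n = d m + 1"
    and "delta_representation n D a \<alpha>"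
    and "\<And>k. k \<ge> 1 \<Longrightarrow> a_hat k = d m - \<bar>a k\<bar>"
    and "\<alpha>_hat = radix_value n a_hat"
  shows "(\<exists>q>0. \<forall>j>0. reduced_inter D \<bar>a j\<bar> \<subseteq> reduced_inter D \<bar>a (j + q)\<bar>) \<longleftrightarrow>
         (\<exists>p>0. \<exists>u \<in> {1..p} \<rightarrow> D. \<exists>v \<in> {1..p} \<rightarrow> D.
            (\<forall>j\<in>{1..p}. u j \<le> v j) \<and> \<alpha>_hat = radix_value n (preperiod_period p u v))"
proof -
  obtain c where c: "c \<ge> 2" and D: "D = (*) c ` {0..int (m - 1)}" and dm: "d m = c * int (m - 1)"
    using uniform_digit_set_arithmetic[OF assms(1,2)] .
  have n: "2 \<le> n" and D_bound: "D \<subseteq> {0..int n - 1}"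
    using assms(1) by (auto simp: digit_set_def)
  have gap: "\<bar>x - y\<bar> \<noteq> 1" if "x \<in> D" "y \<in> D" for x y
  proof
    assume "\<bar>x - y\<bar> = 1"
    moreover have "c dvd \<bar>x - y\<bar>"
      using that by (auto simp: D)
    ultimately show False
      using c by (auto simp: zdvd1_eq)
  qed
  have ex: "\<exists>e. \<bar>a k\<bar> = c * e \<and> 0 \<le> e \<and> e \<le> int (m - 1)" if "k > 0" for k
  proof -
    have "a k \<in> difference_set D"
      using assms(4) that by (simp add: delta_representation_def)
    then obtain i j
      where ij: "a k = c * i - c * j" "i \<in> {0..int (m - 1)}" "j \<in> {0..int (m - 1)}"
      unfolding difference_set_def D by blast
    then have "\<bar>a k\<bar> = c * \<bar>i - j\<bar>"
      using c by (simp add: abs_mult flip: right_diff_distrib)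
    with ij show ?thesis by (intro exI[of _ "\<bar>i - j\<bar>"]) auto
  qed
  have a_hat_D: "a_hat k \<in> D" if k: "k \<ge> 1" for k
  proof -
    obtain e where "\<bar>a k\<bar> = c * e" "0 \<le> e" "e \<le> int (m - 1)"
      using ex[of k] k by auto
    then have "a_hat k = c * (int (m - 1) - e)" "int (m - 1) - e \<in> {0..int (m - 1)}"
      using assms(5)[OF k] dm by (auto simp: algebra_simps)
    then show ?thesis
      unfolding D by blast
  qed
  \<comment> \<open>Passing from \<open>\<bar>a k\<bar>\<close> to \<open>a_hat k\<close> reverses
    the order, so the condition \<open>e' \<le> e\<close> becomes an inequality of hatted digits in
    the direction of the inclusion.\<close>
  have subset_iff: "reduced_inter D \<bar>a j\<bar> \<subseteq> reduced_inter D \<bar>a k\<bar> \<longleftrightarrow> a_hat j \<le> a_hat k"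
    if jk: "j > 0" "k > 0" for j k
  proof -
    obtain e e' where "\<bar>a j\<bar> = c * e" "0 \<le> e" "e \<le> int (m - 1)"
      and "\<bar>a k\<bar> = c * e'" "0 \<le> e'" "e' \<le> int (m - 1)"
      using ex[OF jk(1)] ex[OF jk(2)] by auto
    then show ?thesis
      using arithmetic_reduced_inter_subset_iff[of c e "int (m - 1)" e'] c assms(5)[of j]
        assms(5)[of k] jk
      by (simp add: D)
  qed
  show ?thesis
  proof
    assume "\<exists>q>0. \<forall>j>0. reduced_inter D \<bar>a j\<bar> \<subseteq> reduced_inter D \<bar>a (j + q)\<bar>"
    then obtain q where q: "q > 0" and mono: "\<And>j. j > 0 \<Longrightarrow> a_hat j \<le> a_hat (j + q)"
      using subset_iff by auto
    have bound: "a_hat j \<le> int n - 1" if "j > 0" for j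
      using a_hat_D[of j] D_bound that by auto
    obtain p where p: "p > 0" and le: "\<And>j. j > 0 \<Longrightarrow> a_hat j \<le> a_hat (j + p)"
      and eq: "\<And>k. k > 0 \<Longrightarrow> preperiod_period p a_hat (\<lambda>j. a_hat (j + p)) k = a_hat k"
      using quasi_mono_imp_preperiod_period[of q a_hat, OF q bound mono] by blast
    \<comment> \<open>Agreement at positive indices suffices, since \<open>radix_value\<close> never
      reads index 0.\<close>
    have "\<alpha>_hat = radix_value n (preperiod_period p a_hat (\<lambda>j. a_hat (j + p)))"
      by (simp add: assms(6) radix_value_def eq)
    moreover have "a_hat \<in> {1..p} \<rightarrow> D" "(\<lambda>j. a_hat (j + p)) \<in> {1..p} \<rightarrow> D"
      using a_hat_D by auto
    ultimately show "\<exists>p>0. \<exists>u \<in> {1..p} \<rightarrow> D. \<exists>v \<in> {1..p} \<rightarrow> D.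
        (\<forall>j\<in>{1..p}. u j \<le> v j) \<and> \<alpha>_hat = radix_value n (preperiod_period p u v)"
      using p le by (intro exI[of _ p] conjI bexI[of _ a_hat] bexI[of _ "\<lambda>j. a_hat (j + p)"]) auto
  next
    assume "\<exists>p>0. \<exists>u \<in> {1..p} \<rightarrow> D. \<exists>v \<in> {1..p} \<rightarrow> D.
        (\<forall>j\<in>{1..p}. u j \<le> v j) \<and> \<alpha>_hat = radix_value n (preperiod_period p u v)"
    then obtain p u v where p: "p > 0" and u: "u \<in> {1..p} \<rightarrow> D" and v: "v \<in> {1..p} \<rightarrow> D"
      and uv: "\<forall>j\<in>{1..p}. u j \<le> v j" and val: "\<alpha>_hat = radix_value n (preperiod_period p u v)"
      by blast
    \<comment> \<open>Only the values of the two expansions are known to agree; both have digits in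
      \<open>D\<close>, so uniqueness makes the digits agree as well.\<close>
    have eq: "a_hat k = preperiod_period p u v k" if "k \<ge> 1" for k
    proof (rule radix_value_eq_imp_digits_eq[OF n _ _ _ _ that])
      show "radix_value n a_hat = radix_value n (preperiod_period p u v)"
        using assms(6) val by simp
    qed (use a_hat_D preperiod_period_in[OF p u v] D_bound gap in blast)+
    have "a_hat j \<le> a_hat (j + p)" if "j > 0" for j
      using preperiod_period_le_shift[OF p uv that] that by (simp add: eq)
    then show "\<exists>q>0. \<forall>j>0. reduced_inter D \<bar>a j\<bar> \<subseteq> reduced_inter D \<bar>a (j + q)\<bar>"
      using p subset_iff by (intro exI[of _ p]) auto
  qed
qed

end
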